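(* Let $T$ and $T'$ be commuting contractions on a complex Hilbert space $\mathcal{H}$ such that $T$ is Harnack dominated by $T'$, and let $\mathcal{H}_i$ and $\mathcal{H}_i'$ be the reducing isometric parts in $\mathcal{H}$ of $T$ and $T'$, respectively. Then: (i) $\mathcal{H}_i'\subset\mathcal{H}_i$ and $T'=T$ on $\mathcal{H}_i'$. (ii) If $\mathcal{H}_i\subset\mathcal{N}(D_{T'})$, then $\mathcal{H}_i'$ reduces $T$. In addition, if $\mathcal{N}(I-S_T)$ reduces $T'$, then $\mathcal{H}_i=\mathcal{H}_i'=\mathcal{N}(I-S_{T'})=\mathcal{N}(I-S_T)$. (iii) If the Harnack operator associated with the pair $(T,T')$ is injective, then $\mathcal{H}_i'$ reduces $T$. (iv) If $T$ and $T'$ are Harnack equivalent, then $\mathcal{H}_i=\mathcal{H}_i'$.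
   Context: A contraction is a bounded linear operator of norm at most $1$; $\mathcal{N}(\cdot)$ denotes the kernel; $\operatorname{Re}A=\frac12(A+A^* )$. Harnack domination: for contractions $T,T'$ on the same Hilbert space, $T$ is Harnack dominated by $T'$ if there is a constant $c\ge 1$ such that $\operatorname{Re}p(T)\le c\,\operatorname{Re}p(T')$ for every analytic polynomial $p$ with $\operatorname{Re}p(z)\ge 0$ for $|z|\le 1$. $T$ and $T'$ are Harnack equivalent if each is Harnack dominated by the other. For a contraction $T$: $D_T=(I-T^*T)^{1/2}$ is the defect operator; $S_T$ is the strong limit of $\{T^{*n}T^n\}_n$ (asymptotic limit); the reducing isometric part of $T$ in $\mathcal{H}$ is the largest closed subspace of $\mathcal{H}$ that reduces $T$ (is invariant under $T$ and $T^*$) and on which $T$ is an isometry. Minimal isometric dilation: $V$ on $\mathcal{K}\supset\mathcal{H}$ is a minimal isometric dilation of $T$ if $V$ is an isometry on $\mathcal{K}=\bigvee_{n\ge 0}V^n\mathcal{H}$ (closed linear span) with $P_{\mathcal{H}}V=TP_{\mathcal{H}}$, where $P_{\mathcal{H}}$ is the orthogonal projection of $\mathcal{K}$ onto $\mathcal{H}$. Let $V\in\mathcal{B}(\mathcal{K})$, $V'\in\mathcal{B}(\mathcal{K}')$ be the minimal isometric dilations of $T$, $T'$. When $T$ is Harnack dominated by $T'$ there is a unique bounded operator $A\in\mathcal{B}(\mathcal{K}',\mathcal{K})$ such that $A(\mathcal{H})\subseteq\mathcal{H}$, $A|_{\mathcal{H}}=I$ and $AV'=VA$; this $A$ is the Harnack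 operator associated with $(T,T')$. *)

theory Defs
  imports "HOL-Analysis.Analysis" "HOL-Computational_Algebra.Polynomial"
begin

text \<open>
  Complex Hilbert spaces: complete normed spaces whose norm comes from a complex inner product,
  linear in the first argument. The class extends \<^class>\<open>banach\<close>, so completeness and the
  real normed-space structure are those of the library. Definiteness of the inner product is
  a consequence of definiteness of the norm.
\<close>

class complex_hilbert_space = banach +
  fixes scaleC :: "complex \<Rightarrow> 'a \<Rightarrow> 'a"  (infixr \<open>*\<^sub>C\<close> 75)
    and cinner :: "'a \<Rightarrow> 'a \<Rightarrow> complex"
  assumes scaleC_add_right: "a *\<^sub>C (x + y) = a *\<^sub>C x + a *\<^sub>C y"
    and scaleC_add_left: "(a + b) *\<^sub>C x = a *\<^sub>C x + b *\<^sub>C x"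
    and scaleC_scaleC: "a *\<^sub>C b *\<^sub>C x = (a * b) *\<^sub>C x"
    and scaleC_one: "1 *\<^sub>C x = x"
    and scaleR_scaleC: "r *\<^sub>R x = complex_of_real r *\<^sub>C x"
    and cinner_commute: "cinner x y = cnj (cinner y x)"
    and cinner_add_left: "cinner (x + y) z = cinner x z + cinner y z"
    and cinner_scaleC_left: "cinner (a *\<^sub>C x) y = a * cinner x y"
    and cinner_ge_zero: "0 \<le> Re (cinner x x)"
    and norm_eq_sqrt_cinner: "norm x = sqrt (Re (cinner x x))"

instantiation complex :: complex_hilbert_space
begin

definition "scaleC_complex = ((*) :: complex \<Rightarrow> complex \<Rightarrow> complex)"
definition "cinner_complex = (\<lambda>x y :: complex. x * cnj y)"

instance
  by standard
    (simp_all add: scaleC_complex_def cinner_complex_def algebra_simps scaleR_conv_of_real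
      cmod_def power2_eq_square)

end

definition closed_csubspace :: "'a::complex_hilbert_space set \<Rightarrow> bool" where
  "closed_csubspace M \<longleftrightarrow> subspace M \<and> (\<forall>c. \<forall>x\<in>M. c *\<^sub>C x \<in> M) \<and> closed M"

definition closed_cspan :: "'a::complex_hilbert_space set \<Rightarrow> 'a set" where
  "closed_cspan S = \<Inter> {M. closed_csubspace M \<and> S \<subseteq> M}"

definition bounded_clinear ::
    "('a::complex_hilbert_space \<Rightarrow> 'b::complex_hilbert_space) \<Rightarrow> bool" where
  "bounded_clinear A \<longleftrightarrow> bounded_linear A \<and> (\<forall>c x. A (c *\<^sub>C x) = c *\<^sub>C A x)"

definition contraction :: "('a::complex_hilbert_space \<Rightarrow> 'b::complex_hilbert_space) \<Rightarrow> bool" where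
  "contraction T \<longleftrightarrow> bounded_clinear T \<and> onorm T \<le> 1"

definition isometric_op :: "('a::complex_hilbert_space \<Rightarrow> 'b::complex_hilbert_space) \<Rightarrow> bool" where
  "isometric_op V \<longleftrightarrow> bounded_clinear V \<and> (\<forall>x. norm (V x) = norm x)"

definition null_space :: "('a::complex_hilbert_space \<Rightarrow> 'b::complex_hilbert_space) \<Rightarrow> 'a set" where
  "null_space A = {x. A x = 0}"

definition cadjoint ::
    "('a::complex_hilbert_space \<Rightarrow> 'b::complex_hilbert_space) \<Rightarrow> 'b \<Rightarrow> 'a" where
  "cadjoint A = (THE B. \<forall>x y. cinner (A x) y = cinner x (B y))"

definition positive_op :: "('a::complex_hilbert_space \<Rightarrow> 'a) \<Rightarrow> bool" where
  "positive_op A \<longleftrightarrow>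
     bounded_clinear A \<and> (\<forall>x. cinner (A x) x \<in> \<real> \<and> 0 \<le> Re (cinner (A x) x))"

definition op_le ::
    "('a::complex_hilbert_space \<Rightarrow> 'a) \<Rightarrow> ('a \<Rightarrow> 'a) \<Rightarrow> bool"  (infix \<open>\<le>\<^sub>o\<^sub>p\<close> 50) where
  "A \<le>\<^sub>o\<^sub>p B \<longleftrightarrow> positive_op (\<lambda>x. B x - A x)"

text \<open>A positive operator has exactly one positive square root, so the choice is immaterial.\<close>

definition op_sqrt :: "('a::complex_hilbert_space \<Rightarrow> 'a) \<Rightarrow> 'a \<Rightarrow> 'a" where
  "op_sqrt A = (SOME B. positive_op B \<and> B \<circ> B = A)"

definition defect_op :: "('a::complex_hilbert_space \<Rightarrow> 'a) \<Rightarrow> 'a \<Rightarrow> 'a" where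
  "defect_op T = op_sqrt (\<lambda>x. x - cadjoint T (T x))"

definition asymptotic_limit :: "('a::complex_hilbert_space \<Rightarrow> 'a) \<Rightarrow> 'a \<Rightarrow> 'a" where
  "asymptotic_limit T = (\<lambda>x. lim (\<lambda>n. (cadjoint T ^^ n) ((T ^^ n) x)))"

definition re_op :: "('a::complex_hilbert_space \<Rightarrow> 'a) \<Rightarrow> 'a \<Rightarrow> 'a" where
  "re_op A = (\<lambda>x. (1/2) *\<^sub>R (A x + cadjoint A x))"

definition poly_op :: "complex poly \<Rightarrow> ('a::complex_hilbert_space \<Rightarrow> 'a) \<Rightarrow> 'a \<Rightarrow> 'a" where
  "poly_op p T = (\<lambda>x. \<Sum>i\<le>degree p. coeff p i *\<^sub>C (T ^^ i) x)"

definition harnack_dominated ::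
    "('a::complex_hilbert_space \<Rightarrow> 'a) \<Rightarrow> ('a \<Rightarrow> 'a) \<Rightarrow> bool" where
  "harnack_dominated T T' \<longleftrightarrow>
     (\<exists>c\<ge>1. \<forall>p. (\<forall>z. cmod z \<le> 1 \<longrightarrow> 0 \<le> Re (poly p z)) \<longrightarrow>
        re_op (poly_op p T) \<le>\<^sub>o\<^sub>p (\<lambda>x. c *\<^sub>R re_op (poly_op p T') x))"

definition harnack_equivalent ::
    "('a::complex_hilbert_space \<Rightarrow> 'a) \<Rightarrow> ('a \<Rightarrow> 'a) \<Rightarrow> bool" where
  "harnack_equivalent T T' \<longleftrightarrow> harnack_dominated T T' \<and> harnack_dominated T' T"

definition reduces :: "'a::complex_hilbert_space set \<Rightarrow> ('a \<Rightarrow> 'a) \<Rightarrow> bool" where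
  "reduces M T \<longleftrightarrow> closed_csubspace M \<and> T ` M \<subseteq> M \<and> cadjoint T ` M \<subseteq> M"

definition reducing_isometric_part ::
    "('a::complex_hilbert_space \<Rightarrow> 'a) \<Rightarrow> 'a set" where
  "reducing_isometric_part T =
     (GREATEST M. reduces M T \<and> (\<forall>x\<in>M. norm (T x) = norm x))"

text \<open>
  The inclusion of \<open>H\<close> into the dilation space \<open>K\<close> is an isometric embedding \<open>J\<close>. The orthogonal
  projection of \<open>K\<close> onto \<open>J(H)\<close> is \<open>J J\<^sup>*\<close>, so the projection read as a map from \<open>K\<close> to \<open>H\<close> is
  \<open>J\<^sup>*\<close>, and the last clause says \<open>P\<^sub>H V = T P\<^sub>H\<close>.
\<close>

definition minimal_isometric_dilation ::
    "('h::complex_hilbert_space \<Rightarrow> 'h) \<Rightarrow> ('h \<Rightarrow> 'k::complex_hilbert_space) \<Rightarrow> ('k \<Rightarrow> 'k) \<Rightarrow> bool"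
  where
  "minimal_isometric_dilation T J V \<longleftrightarrow>
     isometric_op J \<and> isometric_op V \<and>
     closed_cspan (\<Union>n. (V ^^ n) ` range J) = UNIV \<and>
     cadjoint J \<circ> V = T \<circ> cadjoint J"

text \<open>
  With \<open>H\<close> embedded in \<open>K'\<close> by \<open>J'\<close> and in \<open>K\<close> by \<open>J\<close>, the equation \<open>A \<circ> J' = J\<close> expresses both
  \<open>A(H) \<subseteq> H\<close> and that \<open>A\<close> is the identity on \<open>H\<close>. Minimality of the dilations makes such an \<open>A\<close>
  unique.
\<close>

definition harnack_operator ::
    "('h::complex_hilbert_space \<Rightarrow> 'k::complex_hilbert_space) \<Rightarrow> ('k \<Rightarrow> 'k) \<Rightarrow>
     ('h \<Rightarrow> 'l::complex_hilbert_space) \<Rightarrow> ('l \<Rightarrow> 'l) \<Rightarrow> ('l \<Rightarrow> 'k) \<Rightarrow> bool" where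
  "harnack_operator J V J' V' A \<longleftrightarrow> bounded_clinear A \<and> A \<circ> J' = J \<and> A \<circ> V' = V \<circ> A"

end

theory Submission imports Defs begin

text \<open>
  Averaging rotated Fejer polynomials over roots of unity upgrades Harnack domination of \<open>T\<close> by
  \<open>T'\<close> to domination of the operator Toeplitz forms, i.e. to
  \<open>\<parallel>\<Sum>j. V\<^sup>j (h j)\<parallel>\<^sup>2 \<le> c \<parallel>\<Sum>j. V'\<^sup>j (h j)\<parallel>\<^sup>2\<close>, without constructing the dilations
  \<open>V\<close>, \<open>V'\<close>. Two vectors suffice to see that \<open>T x = T' x\<close> whenever \<open>\<parallel>T' x\<parallel> = \<parallel>x\<parallel>\<close>. On the
  reducing isometric part of \<open>T'\<close>, commutation then gives
  \<open>T\<^sup>* h = T\<^sup>* T'\<^sup>* T h = T'\<^sup>* T\<^sup>* T h = T'\<^sup>* h\<close>, so this part reduces \<open>T\<close>; parts (i), (iii), (iv)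
  and the first half of (ii) follow. For the second half of (ii), a telescoping argument applied
  to the forms shows that \<open>T z = T' z\<close> as soon as all powers of \<open>T\<close> preserve the norm of
  \<open>T z - T' z\<close>.
\<close>

section \<open>Complex Hilbert spaces\<close>

lemma cinner_self: "cinner x x = of_real ((norm x)\<^sup>2)"
proof -
  have "Im (cinner x x) = 0"
    using arg_cong[OF cinner_commute[of x x], of Im] by simp
  then show ?thesis
    by (simp add: complex_eq_iff norm_eq_sqrt_cinner cinner_ge_zero)
qed

lemma cinner_add_right: "cinner x (y + z) = cinner x y + cinner x z"
  by (metis cinner_add_left cinner_commute complex_cnj_add)

lemma cinner_scaleC_right: "cinner x (a *\<^sub>C y) = cnj a * cinner x y"
  by (metis cinner_commute cinner_scaleC_left complex_cnj_mult)

lemma Re_cinner_commute: "Re (cinner x y) = Re (cinner y x)"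
  by (subst cinner_commute) simp

lemma norm_cinner_le: "cmod (cinner x y) \<le> norm x * norm y"
proof (cases "y = 0")
  case True
  then show ?thesis
    using cinner_add_right[of x 0 0] by simp
next
  case False
  define z where "z = of_real ((norm y)\<^sup>2) *\<^sub>C x + (- cinner x y) *\<^sub>C y"
  have "cinner z z = of_real ((norm y)\<^sup>2) * (of_real ((norm x)\<^sup>2) * of_real ((norm y)\<^sup>2)
      - cinner x y * cnj (cinner x y))"
    unfolding z_def
    by (simp add: cinner_add_left cinner_add_right cinner_scaleC_left cinner_scaleC_right
        cinner_self[of x] cinner_self[of y] cinner_commute[of y x] algebra_simps)
  also have "\<dots> = of_real ((norm y)\<^sup>2 * ((norm x * norm y)\<^sup>2 - (cmod (cinner x y))\<^sup>2))"
    by (simp add: power_mult_distrib flip: complex_norm_square)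
  finally have "0 \<le> (norm y)\<^sup>2 * ((norm x * norm y)\<^sup>2 - (cmod (cinner x y))\<^sup>2)"
    using cinner_ge_zero[of z] by simp
  then have "(cmod (cinner x y))\<^sup>2 \<le> (norm x * norm y)\<^sup>2"
    using False by (simp add: zero_le_mult_iff)
  then show ?thesis
    by (rule power2_le_imp_le) simp
qed

interpretation cinner: bounded_bilinear "cinner :: 'a::complex_hilbert_space \<Rightarrow> 'a \<Rightarrow> complex"
proof
  fix r :: real and x y :: 'a
  show "cinner (r *\<^sub>R x) y = r *\<^sub>R cinner x y" "cinner x (r *\<^sub>R y) = r *\<^sub>R cinner x y"
    by (simp_all add: scaleR_scaleC[where 'a = 'a] cinner_scaleC_left cinner_scaleC_right
        scaleR_conv_of_real)
  show "\<exists>K. \<forall>x y :: 'a. norm (cinner x y) \<le> norm x * norm y * K"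
    by (intro exI[of _ 1]) (simp add: norm_cinner_le)
qed (simp_all add: cinner_add_left cinner_add_right)

lemma norm_scaleC: "norm (a *\<^sub>C x) = cmod a * norm x"
proof -
  have "complex_of_real ((norm (a *\<^sub>C x))\<^sup>2) = (a * cnj a) * cinner x x"
    by (simp only: cinner_scaleC_left cinner_scaleC_right mult_ac flip: cinner_self)
  also have "\<dots> = of_real ((cmod a * norm x)\<^sup>2)"
    by (simp only: cinner_self power_mult_distrib of_real_mult flip: complex_norm_square)
  finally show ?thesis
    by (simp only: of_real_eq_iff power2_eq_iff_nonneg norm_ge_zero mult_nonneg_nonneg)
qed

interpretation scaleC: bounded_bilinear "scaleC :: complex \<Rightarrow> 'a::complex_hilbert_space \<Rightarrow> 'a"
proof
  fix r :: real and a :: complex and x :: 'a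
  show "(r *\<^sub>R a) *\<^sub>C x = r *\<^sub>R a *\<^sub>C x" "a *\<^sub>C r *\<^sub>R x = r *\<^sub>R a *\<^sub>C x"
    by (simp_all add: scaleR_scaleC[where 'a = 'a] scaleC_scaleC scaleR_conv_of_real mult.commute)
  show "\<exists>K. \<forall>a (x :: 'a). norm (a *\<^sub>C x) \<le> norm a * norm x * K"
    by (intro exI[of _ 1]) (simp add: norm_scaleC)
qed (simp_all add: scaleC_add_left scaleC_add_right)

lemma Re_cinner_le: "Re (cinner x y) \<le> norm x * norm y"
  using complex_Re_le_cmod norm_cinner_le by (rule order_trans)

lemma norm_add_power2: "(norm (x + y))\<^sup>2 = (norm x)\<^sup>2 + 2 * Re (cinner x y) + (norm y)\<^sup>2"
  for x :: "'a::complex_hilbert_space"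
proof -
  have "(norm (x + y))\<^sup>2 = Re (cinner (x + y) (x + y))"
    by (simp add: cinner_self)
  also have "\<dots> = (norm x)\<^sup>2 + 2 * Re (cinner x y) + (norm y)\<^sup>2"
    by (simp add: cinner.add_left cinner.add_right cinner_self[of x] cinner_self[of y]
        Re_cinner_commute[of y x])
  finally show ?thesis .
qed

lemma norm_diff_power2: "(norm (x - y))\<^sup>2 = (norm x)\<^sup>2 - 2 * Re (cinner x y) + (norm y)\<^sup>2"
  for x :: "'a::complex_hilbert_space"
  using norm_add_power2[of x "- y"] by (simp add: cinner.minus_right)

lemma cinner_eqI:
  assumes "\<And>x. cinner x y = cinner x z"
  shows "y = z"
proof -
  have "cinner (y - z) (y - z) = 0"
    using assms[of "y - z"] by (simp add: cinner.diff_right)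
  then show ?thesis
    by (simp add: cinner_self)
qed

lemma Cauchy_if_norm_diff_power2_le:
  fixes X :: "nat \<Rightarrow> 'a::real_normed_vector" and e :: "nat \<Rightarrow> real"
  assumes e_tendsto: "e \<longlonglongrightarrow> 0"
    and norm_diff_le: "\<And>m n. m \<le> n \<Longrightarrow> (norm (X m - X n))\<^sup>2 \<le> e m + e n"
  shows "Cauchy X"
proof (rule CauchyI')
  fix r :: real assume "0 < r"
  then have "\<forall>\<^sub>F n in sequentially. e n < r\<^sup>2 / 2"
    using order_tendstoD(2)[OF e_tendsto, of "r\<^sup>2 / 2"] by simp
  then obtain M where tail: "\<And>n. n \<ge> M \<Longrightarrow> e n < r\<^sup>2 / 2"
    unfolding eventually_sequentially by blast
  have "dist (X m) (X n) < r" if "m \<ge> M" "n > m" for m n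
  proof -
    have "(norm (X m - X n))\<^sup>2 < r\<^sup>2"
      using norm_diff_le[of m n] tail[of m] tail[of n] that by simp
    then show ?thesis
      using \<open>0 < r\<close> by (simp add: dist_norm power2_less_imp_less)
  qed
  then show "\<exists>M. \<forall>m\<ge>M. \<forall>n>m. dist (X m) (X n) < r"
    by blast
qed

section \<open>The Riesz representation theorem\<close>

definition riesz_functional :: "('a::complex_hilbert_space \<Rightarrow> real) \<Rightarrow> 'a \<Rightarrow> real" where
  "riesz_functional g x = (norm x)\<^sup>2 - 2 * g x"

lemma bdd_below_riesz_functional:
  assumes "bounded_linear g"
  shows "bdd_below (range (riesz_functional g))"
proof -
  interpret g: bounded_linear g by fact
  obtain K where g_le: "\<And>x. norm (g x) \<le> norm x * K"
    using g.bounded by blast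
  have "- K\<^sup>2 \<le> riesz_functional g x" for x
    using g_le[of x] zero_le_power2[of "norm x - K"]
    by (simp add: riesz_functional_def power2_eq_square algebra_simps abs_le_iff)
  then show ?thesis
    by (rule bdd_belowI2)
qed

lemma norm_diff_power2_le_riesz_functional:
  assumes "bounded_linear g" and lower: "\<And>x. d \<le> riesz_functional g x"
  shows "(norm (x - y))\<^sup>2 \<le> 2 * (riesz_functional g x - d) + 2 * (riesz_functional g y - d)"
proof -
  interpret g: bounded_linear g by fact
  have "riesz_functional g ((1/2) *\<^sub>R (x + y)) = (1/4) * (norm (x + y))\<^sup>2 - g x - g y"
    by (simp add: riesz_functional_def g.add g.scaleR power_divide) argo
  then show ?thesis
    using lower[of "(1/2) *\<^sub>R (x + y)"] norm_add_power2[of x y] norm_diff_power2[of x y]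
    unfolding riesz_functional_def[of g x] riesz_functional_def[of g y] by argo
qed

lemma riesz_functional_has_minimizer:
  assumes g: "bounded_linear g"
  shows "\<exists>z. \<forall>x. riesz_functional g z \<le> riesz_functional g x"
proof -
  define \<phi> where "\<phi> = riesz_functional g"
  define d where "d = Inf (range \<phi>)"
  have d_le: "d \<le> \<phi> x" for x
    unfolding d_def \<phi>_def by (rule cInf_lower[OF _ bdd_below_riesz_functional[OF g]]) simp
  have "\<exists>x. \<phi> x < d + inverse (real (Suc n))" for n
    using cInf_lessD[of "range \<phi>" "d + inverse (real (Suc n))"] by (auto simp: d_def)
  then obtain X where X_less: "\<And>n. \<phi> (X n) < d + inverse (real (Suc n))"
    by metis
  have \<phi>_X: "(\<lambda>n. \<phi> (X n)) \<longlonglongrightarrow> d"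
  proof (rule tendsto_sandwich[OF _ _ tendsto_const LIMSEQ_inverse_real_of_nat_add])
    show "\<forall>\<^sub>F n in sequentially. \<phi> (X n) \<le> d + inverse (real (Suc n))"
      using X_less by (simp add: less_imp_le)
  qed (simp add: d_le)
  have "(\<lambda>n. 2 * (\<phi> (X n) - d)) \<longlonglongrightarrow> 2 * (d - d)"
    by (intro tendsto_intros \<phi>_X)
  then have "(\<lambda>n. 2 * (\<phi> (X n) - d)) \<longlonglongrightarrow> 0"
    by simp
  then have "Cauchy X"
    by (rule Cauchy_if_norm_diff_power2_le)
      (unfold \<phi>_def, rule norm_diff_power2_le_riesz_functional[OF g d_le[unfolded \<phi>_def]])
  then obtain z where X_z: "X \<longlonglongrightarrow> z"
    using Cauchy_convergent_iff convergent_def by blast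
  have "(\<lambda>n. \<phi> (X n)) \<longlonglongrightarrow> \<phi> z"
    unfolding \<phi>_def riesz_functional_def
    by (intro tendsto_intros X_z bounded_linear.tendsto[OF g])
  then have "\<phi> z = d"
    using \<phi>_X by (rule LIMSEQ_unique)
  then show ?thesis
    using d_le by (auto simp: \<phi>_def)
qed

lemma linear_coeff_eq_0_if_quadratic_nonneg:
  fixes a b :: real
  assumes "0 \<le> a" and nonneg: "\<And>t. 0 \<le> a * t\<^sup>2 + b * t"
  shows "b = 0"
proof -
  define t where "t = - b / (a + 1)"
  have b_eq: "b = - (a + 1) * t"
    using \<open>0 \<le> a\<close> by (simp add: t_def field_simps)
  have "a * t\<^sup>2 + b * t = - t\<^sup>2"
    unfolding b_eq by (simp add: power2_eq_square algebra_simps)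
  then have "t = 0"
    using nonneg[of t] by simp
  then show ?thesis
    by (simp add: b_eq)
qed

lemma riesz_representation_real:
  fixes g :: "'a::complex_hilbert_space \<Rightarrow> real"
  assumes "bounded_linear g"
  shows "\<exists>z. \<forall>x. g x = Re (cinner x z)"
proof -
  interpret g: bounded_linear g by fact
  obtain z where min: "\<And>x. riesz_functional g z \<le> riesz_functional g x"
    using riesz_functional_has_minimizer[OF assms] by blast
  have "g x = Re (cinner x z)" for x
  proof -
    have "0 \<le> (norm x)\<^sup>2 * t\<^sup>2 + 2 * (Re (cinner x z) - g x) * t" for t
      using min[of "z + t *\<^sub>R x"] Re_cinner_commute[of x z]
      by (simp add: riesz_functional_def norm_add_power2 g.add g.scaleR cinner.scaleR_right
          algebra_simps)
    then have "2 * (Re (cinner x z) - g x) = 0"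
      by (rule linear_coeff_eq_0_if_quadratic_nonneg[rotated]) simp
    then show ?thesis by simp
  qed
  then show ?thesis by blast
qed

lemma bounded_clinear_imp_bounded_linear: "bounded_clinear A \<Longrightarrow> bounded_linear A"
  by (simp add: bounded_clinear_def)

lemma bounded_clinear_scaleC: "bounded_clinear A \<Longrightarrow> A (c *\<^sub>C x) = c *\<^sub>C A x"
  by (simp add: bounded_clinear_def)

lemma riesz_representation:
  fixes f :: "'a::complex_hilbert_space \<Rightarrow> complex"
  assumes f: "bounded_clinear f"
  shows "\<exists>z. \<forall>x. f x = cinner x z"
proof -
  have "bounded_linear (\<lambda>x. Re (f x))"
    by (intro bounded_linear_compose[OF bounded_linear_Re] bounded_clinear_imp_bounded_linear f)
  then obtain z where Re_f: "\<And>x. Re (f x) = Re (cinner x z)"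
    using riesz_representation_real by blast
  have "f x = cinner x z" for x
    using Re_f[of x] Re_f[of "\<i> *\<^sub>C x"]
    by (simp add: bounded_clinear_scaleC[OF f] scaleC_complex_def cinner_scaleC_left complex_eq_iff)
  then show ?thesis by blast
qed

section \<open>Bounded operators and adjoints\<close>

lemma bounded_clinear_id: "bounded_clinear id"
  by (simp add: bounded_clinear_def id_def)

lemma bounded_clinear_compose:
  assumes "bounded_clinear A" "bounded_clinear B"
  shows "bounded_clinear (A \<circ> B)"
  using assms bounded_linear_compose[of A B] by (simp add: bounded_clinear_def o_def)

lemma bounded_clinear_diff:
  assumes "bounded_clinear A" "bounded_clinear B"
  shows "bounded_clinear (\<lambda>x. A x - B x)"
  using assms by (simp add: bounded_clinear_def bounded_linear_sub scaleC.diff_right)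

lemma bounded_clinear_funpow: "bounded_clinear T \<Longrightarrow> bounded_clinear (T ^^ n)"
  for T :: "'a::complex_hilbert_space \<Rightarrow> 'a"
  by (induction n) (simp_all add: bounded_clinear_id bounded_clinear_compose)

lemma bounded_clinear_poly_op:
  assumes "bounded_clinear T"
  shows "bounded_clinear (poly_op p T)"
proof -
  note T_pow = bounded_clinear_funpow[OF assms]
  have "bounded_linear (poly_op p T)"
    unfolding poly_op_def
    by (intro bounded_linear_sum bounded_linear_compose[OF scaleC.bounded_linear_right]
        bounded_clinear_imp_bounded_linear T_pow)
  moreover have "poly_op p T (c *\<^sub>C x) = c *\<^sub>C poly_op p T x" for c x
    by (simp add: poly_op_def bounded_clinear_scaleC[OF T_pow] scaleC.sum_right scaleC_scaleC
        mult.commute)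
  ultimately show ?thesis
    by (simp add: bounded_clinear_def)
qed

lemma cadjoint_eqI:
  assumes "\<And>x y. cinner (A x) y = cinner x (B y)"
  shows "cadjoint A = B"
  unfolding cadjoint_def
proof (rule the_equality)
  fix C assume C_adjoint: "\<forall>x y. cinner (A x) y = cinner x (C y)"
  show "C = B"
    by (rule ext, rule cinner_eqI) (metis assms C_adjoint)
qed (use assms in blast)

lemma cinner_cadjoint:
  assumes A: "bounded_clinear A"
  shows "cinner (A x) y = cinner x (cadjoint A y)"
proof -
  have "bounded_clinear (\<lambda>x. cinner (A x) y)" for y
    unfolding bounded_clinear_def
    using bounded_linear_compose[OF cinner.bounded_linear_left
        bounded_clinear_imp_bounded_linear[OF A]]
    by (simp add: bounded_clinear_scaleC[OF A] cinner_scaleC_left scaleC_complex_def)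
  then have "\<exists>z. \<forall>x. cinner (A x) y = cinner x z" for y
    by (rule riesz_representation)
  then obtain B where "\<And>x y. cinner (A x) y = cinner x (B y)"
    by metis
  then show ?thesis
    by (simp add: cadjoint_eqI[of A B])
qed

lemma norm_cadjoint_le:
  assumes A: "bounded_clinear A"
  shows "norm (cadjoint A y) \<le> onorm A * norm y"
proof (cases "cadjoint A y = 0")
  case True
  then show ?thesis
    using onorm_pos_le[OF bounded_clinear_imp_bounded_linear[OF A]] by simp
next
  case False
  have "(norm (cadjoint A y))\<^sup>2 = Re (cinner (A (cadjoint A y)) y)"
    by (simp add: cinner_cadjoint[OF A] cinner_self)
  also have "\<dots> \<le> norm (A (cadjoint A y)) * norm y"
    by (rule Re_cinner_le)
  also have "\<dots> \<le> onorm A * norm (cadjoint A y) * norm y"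
    by (intro mult_right_mono onorm bounded_clinear_imp_bounded_linear A) simp
  finally show ?thesis
    using False by (simp add: power2_eq_square mult_ac)
qed

lemma bounded_clinear_cadjoint:
  assumes A: "bounded_clinear A"
  shows "bounded_clinear (cadjoint A)"
proof -
  have add: "cadjoint A (y + z) = cadjoint A y + cadjoint A z" for y z
    by (rule cinner_eqI) (simp add: cinner.add_right flip: cinner_cadjoint[OF A])
  have scale: "cadjoint A (c *\<^sub>C y) = c *\<^sub>C cadjoint A y" for c y
    by (rule cinner_eqI) (simp add: cinner_scaleC_right flip: cinner_cadjoint[OF A])
  have "bounded_linear (cadjoint A)"
  proof (rule bounded_linear_intro)
    show "norm (cadjoint A y) \<le> norm y * onorm A" for y
      using norm_cadjoint_le[OF A] by (simp add: mult.commute)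
  qed (simp_all add: add scale scaleR_scaleC)
  then show ?thesis
    by (simp add: bounded_clinear_def scale)
qed

lemma onorm_cadjoint_le:
  assumes A: "bounded_clinear A"
  shows "onorm (cadjoint A) \<le> onorm A"
  using onorm_pos_le[OF bounded_clinear_imp_bounded_linear[OF A]] norm_cadjoint_le[OF A]
  by (rule onorm_bound)

lemma cadjoint_id: "cadjoint id = id"
  by (rule cadjoint_eqI) simp

lemma cadjoint_compose:
  assumes "bounded_clinear A" "bounded_clinear B"
  shows "cadjoint (A \<circ> B) = cadjoint B \<circ> cadjoint A"
  by (rule cadjoint_eqI) (simp add: cinner_cadjoint assms)

lemma cadjoint_funpow: "bounded_clinear T \<Longrightarrow> cadjoint (T ^^ n) = cadjoint T ^^ n"
  for T :: "'a::complex_hilbert_space \<Rightarrow> 'a"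
proof (induction n)
  case (Suc n)
  then have "cadjoint (T ^^ Suc n) = cadjoint T ^^ n \<circ> cadjoint T"
    by (simp add: cadjoint_compose bounded_clinear_funpow)
  then show ?case
    by (simp only: funpow_Suc_right)
qed (simp add: cadjoint_id)

lemma cadjoint_commute:
  assumes "bounded_clinear S" "bounded_clinear T" "S \<circ> T = T \<circ> S"
  shows "cadjoint S \<circ> cadjoint T = cadjoint T \<circ> cadjoint S"
  by (simp only: assms(3) cadjoint_compose[OF assms(1,2), symmetric]
      cadjoint_compose[OF assms(2,1), symmetric])

lemma Re_cinner_re_op:
  assumes "bounded_clinear A"
  shows "Re (cinner (re_op A x) x) = Re (cinner (A x) x)"
proof -
  have "Re (cinner (cadjoint A x) x) = Re (cinner (A x) x)"
    by (metis Re_cinner_commute assms cinner_cadjoint)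
  then show ?thesis
    by (simp add: re_op_def cinner.scaleR_left cinner.add_left)
qed

lemma closed_csubspace_vimage:
  assumes A: "bounded_clinear A" and M: "closed_csubspace M"
  shows "closed_csubspace (A -` M)"
  unfolding closed_csubspace_def
proof (intro conjI allI ballI)
  note lin = bounded_clinear_imp_bounded_linear[OF A]
  show "subspace (A -` M)"
    using M by (intro linear_subspace_vimage bounded_linear.linear lin)
      (simp add: closed_csubspace_def)
  show "closed (A -` M)"
    using M by (intro closed_vimage linear_continuous_on lin) (simp add: closed_csubspace_def)
  fix c x assume "x \<in> A -` M"
  then show "c *\<^sub>C x \<in> A -` M"
    using M by (simp add: closed_csubspace_def bounded_clinear_scaleC[OF A])
qed

lemma closed_csubspace_null_space:
  assumes "bounded_clinear A"
  shows "closed_csubspace (null_space A)"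
proof -
  have "closed_csubspace (A -` {0})"
    by (rule closed_csubspace_vimage[OF assms]) (simp add: closed_csubspace_def scaleC.zero_right)
  then show ?thesis
    by (simp add: null_space_def vimage_def)
qed

lemma closed_csubspace_INT:
  assumes "\<And>i. i \<in> I \<Longrightarrow> closed_csubspace (M i)"
  shows "closed_csubspace (\<Inter>i\<in>I. M i)"
  using assms by (simp add: closed_csubspace_def subspace_def closed_INT)

section \<open>Contractions\<close>

lemma contraction_imp_bounded_clinear: "contraction A \<Longrightarrow> bounded_clinear A"
  by (simp add: contraction_def)

lemma contraction_norm_le:
  assumes A: "contraction A"
  shows "norm (A x) \<le> norm x"
proof -
  have "norm (A x) \<le> onorm A * norm x"
    by (intro onorm bounded_clinear_imp_bounded_linear contraction_imp_bounded_clinear A)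
  also have "\<dots> \<le> 1 * norm x"
    using A by (intro mult_right_mono) (simp_all add: contraction_def)
  finally show ?thesis by simp
qed

lemma contractionI:
  assumes "bounded_clinear A" "\<And>x. norm (A x) \<le> norm x"
  shows "contraction A"
  using assms by (auto simp: contraction_def intro: onorm_bound)

lemma contraction_funpow:
  fixes T :: "'a::complex_hilbert_space \<Rightarrow> 'a"
  assumes T: "contraction T"
  shows "contraction (T ^^ n)"
proof (rule contractionI)
  show "norm ((T ^^ n) x) \<le> norm x" for x
    by (induction n) (auto intro: order_trans[OF contraction_norm_le[OF T]])
qed (intro bounded_clinear_funpow contraction_imp_bounded_clinear T)

lemma contraction_cadjoint: "contraction A \<Longrightarrow> contraction (cadjoint A)"
  using onorm_cadjoint_le[of A] by (simp add: contraction_def bounded_clinear_cadjoint)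

lemma decseq_norm_funpow: "contraction T \<Longrightarrow> decseq (\<lambda>n. norm ((T ^^ n) x))"
  for T :: "'a::complex_hilbert_space \<Rightarrow> 'a"
  by (simp add: decseq_Suc_iff contraction_norm_le)

lemma norm_diff_cadjoint_power2_le:
  assumes A: "contraction A"
  shows "(norm (x - cadjoint A (A x)))\<^sup>2 \<le> (norm x)\<^sup>2 - (norm (A x))\<^sup>2"
proof -
  have "Re (cinner x (cadjoint A (A x))) = (norm (A x))\<^sup>2"
    by (simp add: cinner_self flip: cinner_cadjoint[OF contraction_imp_bounded_clinear[OF A]])
  moreover have "(norm (cadjoint A (A x)))\<^sup>2 \<le> (norm (A x))\<^sup>2"
    by (intro power_mono contraction_norm_le contraction_cadjoint A) simp
  ultimately show ?thesis
    by (simp add: norm_diff_power2)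
qed

lemma cadjoint_apply_eq_iff:
  assumes A: "contraction A"
  shows "cadjoint A (A x) = x \<longleftrightarrow> norm (A x) = norm x"
proof
  assume "cadjoint A (A x) = x"
  then have "cinner (A x) (A x) = cinner x x"
    by (simp add: cinner_cadjoint[OF contraction_imp_bounded_clinear[OF A]])
  then show "norm (A x) = norm x"
    by (simp only: cinner_self of_real_eq_iff power2_eq_iff_nonneg norm_ge_zero)
next
  assume "norm (A x) = norm x"
  then show "cadjoint A (A x) = x"
    using norm_diff_cadjoint_power2_le[OF A, of x] by simp
qed

lemma cinner_contraction_eq:
  assumes "contraction A" "norm (A y) = norm y"
  shows "cinner (A x) (A y) = cinner x y"
  using assms cadjoint_apply_eq_iff[of A y]
  by (simp add: cinner_cadjoint contraction_imp_bounded_clinear)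

lemma cadjoint_eq_if_commute_isometric:
  assumes S: "contraction S" and T: "contraction T" and comm: "S \<circ> T = T \<circ> S"
    and eq: "S x = T x" and iso: "norm (T x) = norm x"
  shows "cadjoint S x = cadjoint T x"
proof -
  have "cadjoint S x = cadjoint S (cadjoint T (S x))"
    using iso cadjoint_apply_eq_iff[OF T, of x] by (simp add: eq)
  also have "\<dots> = cadjoint T (cadjoint S (S x))"
    using cadjoint_commute[OF contraction_imp_bounded_clinear[OF S]
        contraction_imp_bounded_clinear[OF T] comm] by (metis comp_apply)
  also have "\<dots> = cadjoint T x"
    using iso cadjoint_apply_eq_iff[OF S, of x] by (simp add: eq)
  finally show ?thesis .
qed

section \<open>Powers of a map\<close>

lemma funpow_add_apply: "(f ^^ m) ((f ^^ n) x) = (f ^^ (m + n)) x"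
  by (simp add: funpow_add)

lemma funpow_mem_invariant: "f ` M \<subseteq> M \<Longrightarrow> x \<in> M \<Longrightarrow> (f ^^ n) x \<in> M"
  by (induction n) auto

lemma funpow_commute_funpow:
  assumes "S \<circ> T = T \<circ> S"
  shows "(S ^^ m) ((T ^^ n) x) = (T ^^ n) ((S ^^ m) x)"
proof -
  have "S ((T ^^ n) x) = (T ^^ n) (S x)" for x
    by (induction n) (use fun_cong[OF assms] in simp_all)
  then show ?thesis
    by (induction m) simp_all
qed

section \<open>The isometric parts of a contraction\<close>

definition isometric_part :: "('a::complex_hilbert_space \<Rightarrow> 'a) \<Rightarrow> 'a set" where
  "isometric_part T = {x. \<forall>n. norm ((T ^^ n) x) = norm x}"

lemma isometric_partD: "x \<in> isometric_part T \<Longrightarrow> norm ((T ^^ n) x) = norm x"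
  by (simp add: isometric_part_def)

lemma norm_eq_on_isometric_part: "x \<in> isometric_part T \<Longrightarrow> norm (T x) = norm x"
  using isometric_partD[of x T 1] by simp

lemma funpow_mem_isometric_part: "x \<in> isometric_part T \<Longrightarrow> (T ^^ n) x \<in> isometric_part T"
  by (simp add: isometric_part_def funpow_add_apply)

lemma isometric_part_invariant: "T ` isometric_part T \<subseteq> isometric_part T"
  using funpow_mem_isometric_part[of _ T 1] by auto

lemma subset_isometric_part:
  assumes inv: "T ` M \<subseteq> M" and iso: "\<And>x. x \<in> M \<Longrightarrow> norm (T x) = norm x"
  shows "M \<subseteq> isometric_part T"
proof
  fix x assume "x \<in> M"
  then have "norm ((T ^^ n) x) = norm x" for n
    by (induction n) (simp_all add: iso funpow_mem_invariant[OF inv])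
  then show "x \<in> isometric_part T"
    by (simp add: isometric_part_def)
qed

lemma cinner_funpow_isometric_part:
  assumes "contraction T" "y \<in> isometric_part T"
  shows "cinner ((T ^^ n) x) ((T ^^ n) y) = cinner x y"
  using assms by (intro cinner_contraction_eq contraction_funpow isometric_partD)

lemma closed_csubspace_isometric_part:
  assumes T: "contraction T"
  shows "closed_csubspace (isometric_part T)"
proof -
  have "isometric_part T = (\<Inter>n. null_space (\<lambda>x. (cadjoint (T ^^ n) \<circ> T ^^ n) x - id x))"
    by (auto simp: isometric_part_def null_space_def
        cadjoint_apply_eq_iff[OF contraction_funpow[OF T]])
  also have "closed_csubspace \<dots>"
    by (intro closed_csubspace_INT closed_csubspace_null_space bounded_clinear_diff
        bounded_clinear_compose bounded_clinear_cadjoint bounded_clinear_id bounded_clinear_funpow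
        contraction_imp_bounded_clinear T)
  finally show ?thesis .
qed

lemma norm_cadjoint_funpow_diff_power2_le:
  fixes T :: "'a::complex_hilbert_space \<Rightarrow> 'a"
  assumes T: "contraction T" and "m \<le> n"
  shows "(norm ((cadjoint T ^^ m) ((T ^^ m) x) - (cadjoint T ^^ n) ((T ^^ n) x)))\<^sup>2
    \<le> (norm ((T ^^ m) x))\<^sup>2 - (norm ((T ^^ n) x))\<^sup>2"
proof -
  define S where "S = T ^^ (n - m)"
  define y where "y = (T ^^ m) x"
  have S: "contraction S"
    unfolding S_def by (rule contraction_funpow[OF T])
  have T_n: "T ^^ n = S \<circ> T ^^ m"
    using \<open>m \<le> n\<close> by (simp add: S_def flip: funpow_add)
  note lin = contraction_imp_bounded_clinear
  have "(cadjoint T ^^ m) ((T ^^ m) x) - (cadjoint T ^^ n) ((T ^^ n) x)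
      = cadjoint (T ^^ m) (y - cadjoint S (S y))"
    using linear_simps(2)[OF bounded_clinear_imp_bounded_linear[OF
          bounded_clinear_cadjoint[OF lin[OF contraction_funpow[OF T]]]]]
    by (simp add: T_n y_def cadjoint_compose lin contraction_funpow T S
        flip: cadjoint_funpow[OF lin[OF T]])
  then have "(norm ((cadjoint T ^^ m) ((T ^^ m) x) - (cadjoint T ^^ n) ((T ^^ n) x)))\<^sup>2
      \<le> (norm (y - cadjoint S (S y)))\<^sup>2"
    by (simp add: power_mono contraction_norm_le contraction_cadjoint contraction_funpow T)
  also have "\<dots> \<le> (norm y)\<^sup>2 - (norm (S y))\<^sup>2"
    by (rule norm_diff_cadjoint_power2_le[OF S])
  finally show ?thesis
    by (simp add: y_def T_n)
qed

lemma convergent_cadjoint_funpow: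
  fixes T :: "'a::complex_hilbert_space \<Rightarrow> 'a"
  assumes T: "contraction T"
  shows "convergent (\<lambda>n. (cadjoint T ^^ n) ((T ^^ n) x))"
proof -
  have dec: "decseq (\<lambda>n. (norm ((T ^^ n) x))\<^sup>2)"
    using decseq_norm_funpow[OF T, of x] by (simp add: decseq_def power_mono)
  obtain L where lim: "(\<lambda>n. (norm ((T ^^ n) x))\<^sup>2) \<longlonglongrightarrow> L"
    and L_le: "\<And>n. L \<le> (norm ((T ^^ n) x))\<^sup>2"
    using decseq_convergent[OF dec, of 0] by auto
  have "(\<lambda>n. (norm ((T ^^ n) x))\<^sup>2 - L) \<longlonglongrightarrow> 0"
    using tendsto_diff[OF lim tendsto_const[of L]] by simp
  then have "Cauchy (\<lambda>n. (cadjoint T ^^ n) ((T ^^ n) x))"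
  proof (rule Cauchy_if_norm_diff_power2_le)
    fix m n :: nat assume "m \<le> n"
    then show "(norm ((cadjoint T ^^ m) ((T ^^ m) x) - (cadjoint T ^^ n) ((T ^^ n) x)))\<^sup>2
        \<le> (norm ((T ^^ m) x))\<^sup>2 - L + ((norm ((T ^^ n) x))\<^sup>2 - L)"
      using norm_cadjoint_funpow_diff_power2_le[OF T, of m n x] L_le[of n] by linarith
  qed
  then show ?thesis
    by (simp add: Cauchy_convergent_iff)
qed

lemma null_space_asymptotic_limit:
  assumes T: "contraction T"
  shows "null_space (\<lambda>h. h - asymptotic_limit T h) = isometric_part T"
proof (intro subset_antisym subsetI)
  note lin = contraction_imp_bounded_clinear[OF T]
  fix x assume "x \<in> null_space (\<lambda>h. h - asymptotic_limit T h)"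
  then have "(\<lambda>n. (cadjoint T ^^ n) ((T ^^ n) x)) \<longlonglongrightarrow> x"
    using convergent_cadjoint_funpow[OF T, of x]
    by (simp add: null_space_def asymptotic_limit_def convergent_LIMSEQ_iff)
  then have "(\<lambda>n. Re (cinner x ((cadjoint T ^^ n) ((T ^^ n) x)))) \<longlonglongrightarrow> Re (cinner x x)"
    by (intro tendsto_Re cinner.tendsto tendsto_const)
  then have "(\<lambda>n. (norm ((T ^^ n) x))\<^sup>2) \<longlonglongrightarrow> (norm x)\<^sup>2"
    by (simp add: cinner_self flip: cadjoint_funpow[OF lin]
        cinner_cadjoint[OF bounded_clinear_funpow[OF lin]])
  then have "(\<lambda>n. norm ((T ^^ n) x)) \<longlonglongrightarrow> norm x"
    using tendsto_real_sqrt by fastforce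
  then have "norm x \<le> norm ((T ^^ n) x)" for n
    by (rule decseq_ge[OF decseq_norm_funpow[OF T]])
  then show "x \<in> isometric_part T"
    by (simp add: isometric_part_def antisym contraction_norm_le contraction_funpow T)
next
  fix x assume "x \<in> isometric_part T"
  then have "(cadjoint T ^^ n) ((T ^^ n) x) = x" for n
    using cadjoint_apply_eq_iff[OF contraction_funpow[OF T], of n x]
    by (simp add: isometric_partD cadjoint_funpow contraction_imp_bounded_clinear T)
  then show "x \<in> null_space (\<lambda>h. h - asymptotic_limit T h)"
    by (simp add: null_space_def asymptotic_limit_def)
qed

lemma reduces_cadjoint_funpow_mem_isometric_part:
  assumes T: "contraction T"
  shows "reduces {x. \<forall>n. (cadjoint T ^^ n) x \<in> isometric_part T} T" (is "reduces ?M T")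
  unfolding reduces_def
proof (intro conjI image_subsetI)
  have "?M = (\<Inter>n. (cadjoint T ^^ n) -` isometric_part T)"
    by auto
  also have "closed_csubspace \<dots>"
    by (intro closed_csubspace_INT closed_csubspace_vimage closed_csubspace_isometric_part
        bounded_clinear_funpow bounded_clinear_cadjoint contraction_imp_bounded_clinear T)
  finally show "closed_csubspace ?M" .
next
  fix x assume x: "x \<in> ?M"
  then have "x \<in> isometric_part T"
    by (auto dest: spec[of _ 0])
  then have "cadjoint T (T x) = x" "T x \<in> isometric_part T"
    using isometric_part_invariant[of T]
    by (auto simp: cadjoint_apply_eq_iff[OF T] norm_eq_on_isometric_part)
  then have "(cadjoint T ^^ n) (T x) \<in> isometric_part T" for n
    using x by (cases n) (simp_all add: funpow_swap1)
  then show "T x \<in> ?M" by simp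
next
  fix x assume "x \<in> ?M"
  then have "(cadjoint T ^^ Suc n) x \<in> isometric_part T" for n
    by blast
  then show "cadjoint T x \<in> ?M"
    by (simp add: funpow_swap1)
qed

lemma reducing_isometric_part_eq:
  assumes T: "contraction T"
  shows "reducing_isometric_part T = {x. \<forall>n. (cadjoint T ^^ n) x \<in> isometric_part T}"
    (is "_ = ?M")
  unfolding reducing_isometric_part_def
proof (rule Greatest_equality)
  have "?M \<subseteq> isometric_part T"
    by (auto dest: spec[of _ 0])
  then show "reduces ?M T \<and> (\<forall>x\<in>?M. norm (T x) = norm x)"
    using reduces_cadjoint_funpow_mem_isometric_part[OF T] norm_eq_on_isometric_part by blast
next
  fix N assume N: "reduces N T \<and> (\<forall>x\<in>N. norm (T x) = norm x)"
  then have "N \<subseteq> isometric_part T"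
    by (intro subset_isometric_part) (auto simp: reduces_def)
  moreover have "(cadjoint T ^^ n) x \<in> N" if "x \<in> N" for x n
    using N that by (simp add: reduces_def funpow_mem_invariant)
  ultimately show "N \<subseteq> ?M"
    by blast
qed

lemma reduces_reducing_isometric_part:
  "contraction T \<Longrightarrow> reduces (reducing_isometric_part T) T"
  by (simp add: reducing_isometric_part_eq reduces_cadjoint_funpow_mem_isometric_part)

lemma reducing_isometric_part_subset:
  "contraction T \<Longrightarrow> reducing_isometric_part T \<subseteq> isometric_part T"
  by (auto simp: reducing_isometric_part_eq dest: spec[of _ 0])

lemma norm_eq_on_reducing_isometric_part:
  "contraction T \<Longrightarrow> x \<in> reducing_isometric_part T \<Longrightarrow> norm (T x) = norm x"
  using reducing_isometric_part_subset norm_eq_on_isometric_part by blast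

lemma reducing_isometric_part_greatest:
  assumes "contraction T" "reduces M T" "M \<subseteq> isometric_part T"
  shows "M \<subseteq> reducing_isometric_part T"
proof
  fix x assume "x \<in> M"
  then have "(cadjoint T ^^ n) x \<in> M" for n
    using assms(2) by (simp add: reduces_def funpow_mem_invariant)
  then show "x \<in> reducing_isometric_part T"
    using assms by (auto simp: reducing_isometric_part_eq)
qed

section \<open>Fejer polynomials and roots of unity\<close>

text \<open>
  The Taylor coefficients of \<open>(1 + z) / (1 - z)\<close>; \<open>fejer_poly\<close> is a Cesaro mean of the partial sums.
\<close>

definition herglotz_coeff :: "nat \<Rightarrow> complex" where
  "herglotz_coeff k = (if k = 0 then 1 else 2)"

definition fejer_poly :: "nat \<Rightarrow> complex poly" where
  "fejer_poly N = smult (1 / of_nat N) (\<Sum>m<N. \<Sum>k\<le>m. monom (herglotz_coeff k) k)"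

lemma coeff_fejer_poly:
  "coeff (fejer_poly N) k = of_nat (N - k) / of_nat N * herglotz_coeff k"
proof -
  have "coeff (\<Sum>m<N. \<Sum>i\<le>m. monom (herglotz_coeff i) i) k
      = (\<Sum>m<N. if k \<le> m then herglotz_coeff k else 0)"
    by (simp add: coeff_sum if_distrib[where f = "\<lambda>x. coeff x _"] cong: if_cong)
  also have "\<dots> = (\<Sum>m\<in>{k..<N}. herglotz_coeff k)"
    by (rule sum.mono_neutral_cong_right) auto
  finally show ?thesis
    by (simp add: fejer_poly_def)
qed

lemma tendsto_coeff_fejer_poly:
  "(\<lambda>N. coeff (fejer_poly N) k) \<longlonglongrightarrow> herglotz_coeff k"
proof -
  have "(\<lambda>N. 1 - of_nat k / of_nat N) \<longlonglongrightarrow> (1 - 0 :: complex)"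
    by (intro tendsto_diff tendsto_const lim_const_over_n)
  moreover have "\<forall>\<^sub>F N in sequentially.
      1 - of_nat k / of_nat N = (of_nat (N - k) / of_nat N :: complex)"
    using eventually_gt_at_top[of k]
    by eventually_elim (simp add: diff_divide_distrib)
  ultimately have "(\<lambda>N. of_nat (N - k) / of_nat N :: complex) \<longlonglongrightarrow> 1 - 0"
    by (rule Lim_transform_eventually)
  from tendsto_mult_right[OF this, of "herglotz_coeff k"] show ?thesis
    unfolding coeff_fejer_poly by simp
qed

lemma geometric_sum_power2_le_Re_cesaro_sum:
  assumes z: "cmod z \<le> 1"
  shows "(cmod (\<Sum>k<N. z ^ k))\<^sup>2 \<le> Re (\<Sum>m<N. \<Sum>k\<le>m. herglotz_coeff k * z ^ k)"
proof (induction N)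
  case (Suc N)
  define S where "S = (\<Sum>k<N. z ^ k)"
  have shift: "(\<Sum>k<N. z ^ Suc k) = z * S"
    by (simp add: S_def sum_distrib_left)
  have "(\<Sum>k<Suc N. z ^ k) = 1 + z * S"
    unfolding sum.lessThan_Suc_shift shift by simp
  then have "(cmod (\<Sum>k<Suc N. z ^ k))\<^sup>2 = (cmod (z * S))\<^sup>2 + Re (1 + 2 * (z * S))"
    unfolding cmod_power2 by (simp add: power2_eq_square algebra_simps)
  also have "\<dots> \<le> (cmod S)\<^sup>2 + Re (1 + 2 * (z * S))"
    using z by (intro add_right_mono power_mono) (auto simp: norm_mult mult_left_le_one_le)
  also have "1 + 2 * (z * S) = (\<Sum>k\<le>N. herglotz_coeff k * z ^ k)"
    unfolding sum.atMost_shift by (simp add: herglotz_coeff_def shift[symmetric] sum_distrib_left)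
  finally show ?case
    using Suc by (simp add: S_def)
qed simp

definition Re_nonneg_on_disc :: "complex poly \<Rightarrow> bool" where
  "Re_nonneg_on_disc p \<longleftrightarrow> (\<forall>z. cmod z \<le> 1 \<longrightarrow> 0 \<le> Re (poly p z))"

lemma Re_nonneg_on_disc_fejer_poly: "Re_nonneg_on_disc (fejer_poly N)"
  unfolding Re_nonneg_on_disc_def
proof (intro allI impI)
  fix z :: complex assume "cmod z \<le> 1"
  then have "0 \<le> Re (\<Sum>m<N. \<Sum>k\<le>m. herglotz_coeff k * z ^ k)"
    using zero_le_power2 geometric_sum_power2_le_Re_cesaro_sum order_trans by blast
  moreover have "Re (poly (fejer_poly N) z)
      = Re (\<Sum>m<N. \<Sum>k\<le>m. herglotz_coeff k * z ^ k) / real N"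
    by (simp add: fejer_poly_def poly_sum poly_monom)
  ultimately show "0 \<le> Re (poly (fejer_poly N) z)"
    by simp
qed

lemma Re_nonneg_on_disc_rotate:
  assumes "Re_nonneg_on_disc p" "cmod w = 1"
  shows "Re_nonneg_on_disc (pcompose p [:0, w:])"
  using assms by (simp add: Re_nonneg_on_disc_def poly_pcompose norm_mult)

lemma sum_roots_unity_orthogonal:
  assumes "a < M" "b < M"
  shows "(\<Sum>w | w ^ M = 1. w ^ a * cnj w ^ b) = (if a = b then of_nat M else 0)"
proof -
  define \<omega> where "\<omega> j = cis (2 * pi * real j / real M)" for j
  define q where "q = \<omega> a * cnj (\<omega> b)"
  have bij: "bij_betw \<omega> {..<M} {w. w ^ M = 1}"
    unfolding \<omega>_def[abs_def] using assms by (intro Complex.bij_betw_roots_unity) simp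
  have power_commute: "\<omega> i ^ j = \<omega> j ^ i" for i j
    by (simp add: \<omega>_def Complex.DeMoivre mult_ac)
  have "(\<Sum>w | w ^ M = 1. w ^ a * cnj w ^ b) = (\<Sum>s<M. \<omega> s ^ a * cnj (\<omega> s) ^ b)"
    by (rule sum.reindex_bij_betw[OF bij, symmetric])
  also have "\<dots> = (\<Sum>s<M. q ^ s)"
    by (simp add: q_def power_mult_distrib power_commute flip: complex_cnj_power)
  also have "\<dots> = (if a = b then of_nat M else 0)"
  proof (cases "a = b")
    case True
    then have "q = 1"
      by (simp add: q_def \<omega>_def cis_cnj cis_mult)
    then show ?thesis
      using True by simp
  next
    case False
    have "\<omega> a \<noteq> \<omega> b"
      using bij assms False by (auto simp: bij_betw_def dest: inj_onD)
    moreover have "q * \<omega> b = \<omega> a"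
      by (simp add: q_def \<omega>_def cis_cnj cis_mult)
    ultimately have "q \<noteq> 1"
      by auto
    have "\<omega> j ^ M = 1" if "j < M" for j
      using bij that by (auto simp: bij_betw_def)
    then have "q ^ M = 1"
      using assms by (simp add: q_def power_mult_distrib flip: complex_cnj_power)
    then show ?thesis
      using False \<open>q \<noteq> 1\<close> by (simp add: sum_gp_strict)
  qed
  finally show ?thesis .
qed

section \<open>Domination of Toeplitz forms\<close>

definition weighted_toeplitz_form ::
    "(nat \<Rightarrow> complex) \<Rightarrow> ('a::complex_hilbert_space \<Rightarrow> 'a) \<Rightarrow> (nat \<Rightarrow> 'a) \<Rightarrow> nat \<Rightarrow> complex" where
  "weighted_toeplitz_form a T h n =
     (\<Sum>j<n. \<Sum>i\<le>j. a (j - i) * cinner ((T ^^ (j - i)) (h j)) (h i))"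

text \<open>If \<open>V\<close> is an isometric dilation of \<open>T\<close>, this is \<open>\<parallel>\<Sum>j<n. V\<^sup>j (h j)\<parallel>\<^sup>2\<close>.\<close>

definition toeplitz_form ::
    "('a::complex_hilbert_space \<Rightarrow> 'a) \<Rightarrow> (nat \<Rightarrow> 'a) \<Rightarrow> nat \<Rightarrow> real" where
  "toeplitz_form T h n = Re (weighted_toeplitz_form herglotz_coeff T h n)"

lemma toeplitz_form_eq:
  "toeplitz_form T h n =
     (\<Sum>j<n. (norm (h j))\<^sup>2 + 2 * (\<Sum>i<j. Re (cinner ((T ^^ (j - i)) (h j)) (h i))))"
proof -
  have "Re (\<Sum>i\<le>j. herglotz_coeff (j - i) * cinner ((T ^^ (j - i)) (h j)) (h i))
      = (norm (h j))\<^sup>2 + 2 * (\<Sum>i<j. Re (cinner ((T ^^ (j - i)) (h j)) (h i)))" for j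
    by (simp add: herglotz_coeff_def cinner_self sum_distrib_left flip: lessThan_Suc_atMost)
  then show ?thesis
    by (simp add: toeplitz_form_def weighted_toeplitz_form_def)
qed

lemma tendsto_weighted_toeplitz_form:
  assumes "\<And>k. (\<lambda>N. a N k) \<longlonglongrightarrow> b k"
  shows "(\<lambda>N. weighted_toeplitz_form (a N) T h n) \<longlonglongrightarrow> weighted_toeplitz_form b T h n"
  unfolding weighted_toeplitz_form_def by (intro tendsto_intros assms)

lemma poly_op_pcompose_linear:
  "poly_op (pcompose p [:0, w:]) T x = (\<Sum>k\<le>degree p. (w ^ k * coeff p k) *\<^sub>C (T ^^ k) x)"
proof -
  have "degree (pcompose p [:0, w:]) \<le> degree p"
    using degree_pcompose_le[of p "[:0, w:]"] by (simp split: if_splits)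
  then have "poly_op (pcompose p [:0, w:]) T x
      = (\<Sum>k\<le>degree p. coeff (pcompose p [:0, w:]) k *\<^sub>C (T ^^ k) x)"
    unfolding poly_op_def
    by (intro sum.mono_neutral_left) (auto simp: coeff_eq_0 scaleC.zero_left)
  then show ?thesis
    by (simp add: coeff_pcompose_linear)
qed

lemma cinner_poly_op_pcompose_linear:
  assumes T: "bounded_clinear T"
  shows "cinner (poly_op (pcompose p [:0, w:]) T (\<Sum>j<n. cnj w ^ j *\<^sub>C h j))
      (\<Sum>i<n. cnj w ^ i *\<^sub>C h i)
    = (\<Sum>k\<le>degree p. \<Sum>j<n. \<Sum>i<n.
        coeff p k * cinner ((T ^^ k) (h j)) (h i) * (w ^ (k + i) * cnj w ^ j))"
proof -
  note T_pow = bounded_clinear_funpow[OF T]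
  have T_pow_sum: "(T ^^ k) (\<Sum>j<n. cnj w ^ j *\<^sub>C h j)
      = (\<Sum>j<n. cnj w ^ j *\<^sub>C (T ^^ k) (h j))" for k
    by (simp add: bounded_clinear_scaleC[OF T_pow]
        linear_sum[OF bounded_linear.linear[OF bounded_clinear_imp_bounded_linear[OF T_pow]]])
  show ?thesis
    unfolding poly_op_pcompose_linear T_pow_sum
    unfolding cinner.sum_left cinner_scaleC_left
    unfolding cinner.sum_right cinner_scaleC_right
    by (simp add: sum_distrib_left power_add mult_ac)
qed

lemma sum_roots_unity_cinner_poly_op:
  fixes T :: "'a::complex_hilbert_space \<Rightarrow> 'a" and h :: "nat \<Rightarrow> 'a"
  assumes T: "bounded_clinear T" and M: "degree p + n \<le> M"
  defines "g \<equiv> \<lambda>w. \<Sum>j<n. cnj w ^ j *\<^sub>C h j"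
  shows "(\<Sum>w | w ^ M = 1. cinner (poly_op (pcompose p [:0, w:]) T (g w)) (g w))
    = of_nat M * weighted_toeplitz_form (coeff p) T h n"
proof -
  define c where "c k j i = coeff p k * cinner ((T ^^ k) (h j)) (h i)" for k j i
  have "(\<Sum>w | w ^ M = 1. cinner (poly_op (pcompose p [:0, w:]) T (g w)) (g w))
      = (\<Sum>k\<le>degree p. \<Sum>j<n. \<Sum>i<n. \<Sum>w | w ^ M = 1. c k j i * (w ^ (k + i) * cnj w ^ j))"
    unfolding g_def cinner_poly_op_pcompose_linear[OF T] c_def
    by (simp only: sum.swap[where A = "{w. w ^ M = 1}"])
  also have "\<dots> = (\<Sum>k\<le>degree p. \<Sum>j<n. \<Sum>i<n. if k + i = j then of_nat M * c k j i else 0)"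
    using M by (intro sum.cong refl)
      (simp add: sum_roots_unity_orthogonal flip: sum_distrib_left)
  also have "\<dots> = (\<Sum>j<n. \<Sum>i<n. \<Sum>k\<le>degree p. if k + i = j then of_nat M * c k j i else 0)"
    by (simp only: sum.swap[where A = "{..degree p}"])
  also have "\<dots> = (\<Sum>j<n. \<Sum>i\<le>j. of_nat M * c (j - i) j i)"
  proof (rule sum.cong[OF refl], rule sum.mono_neutral_cong_right)
    fix i j :: nat assume "i \<in> {..j}"
    then have "k + i = j \<longleftrightarrow> k = j - i" for k by auto
    then show "(\<Sum>k\<le>degree p. if k + i = j then of_nat M * c k j i else 0)
        = of_nat M * c (j - i) j i"
      by (simp add: c_def coeff_eq_0)
  qed auto
  finally show ?thesis
    by (simp add: weighted_toeplitz_form_def c_def sum_distrib_left mult.assoc)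
qed

lemma harnack_dominated_poly_op_form:
  assumes T: "bounded_clinear T" and T': "bounded_clinear T'" and dom: "harnack_dominated T T'"
  obtains c where "c \<ge> 1"
    "\<And>p x. Re_nonneg_on_disc p \<Longrightarrow>
      Re (cinner (poly_op p T x) x) \<le> c * Re (cinner (poly_op p T' x) x)"
proof -
  obtain c where "c \<ge> 1" and op_le: "\<And>p. Re_nonneg_on_disc p \<Longrightarrow>
      re_op (poly_op p T) \<le>\<^sub>o\<^sub>p (\<lambda>x. c *\<^sub>R re_op (poly_op p T') x)"
    using dom by (auto simp: harnack_dominated_def Re_nonneg_on_disc_def)
  have "Re (cinner (poly_op p T x) x) \<le> c * Re (cinner (poly_op p T' x) x)"
    if "Re_nonneg_on_disc p" for p x
  proof -
    have "0 \<le> Re (cinner (c *\<^sub>R re_op (poly_op p T') x - re_op (poly_op p T) x) x)"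
      using op_le[OF that] by (simp add: op_le_def positive_op_def)
    then show ?thesis
      by (simp add: cinner.diff_left cinner.scaleR_left Re_cinner_re_op bounded_clinear_poly_op
          T T')
  qed
  then show thesis
    using that \<open>c \<ge> 1\<close> by blast
qed

lemma harnack_dominated_weighted_toeplitz_form:
  assumes T: "bounded_clinear T" and T': "bounded_clinear T'" and dom: "harnack_dominated T T'"
  obtains c where "c \<ge> 1"
    "\<And>p h n. Re_nonneg_on_disc p \<Longrightarrow>
      Re (weighted_toeplitz_form (coeff p) T h n)
        \<le> c * Re (weighted_toeplitz_form (coeff p) T' h n)"
proof -
  obtain c where "c \<ge> 1" and form_le: "\<And>p x. Re_nonneg_on_disc p \<Longrightarrow>
      Re (cinner (poly_op p T x) x) \<le> c * Re (cinner (poly_op p T' x) x)"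
    using harnack_dominated_poly_op_form[OF assms] by metis
  have "Re (weighted_toeplitz_form (coeff p) T h n)
      \<le> c * Re (weighted_toeplitz_form (coeff p) T' h n)"
    if p_nonneg: "Re_nonneg_on_disc p" for p h n
  proof -
    define M where "M = Suc (degree p + n)"
    define g where "g w = (\<Sum>j<n. cnj w ^ j *\<^sub>C h j)" for w
    have average: "real M * Re (weighted_toeplitz_form (coeff p) S h n)
        = (\<Sum>w | w ^ M = 1. Re (cinner (poly_op (pcompose p [:0, w:]) S (g w)) (g w)))"
      if "bounded_clinear S" for S
      using arg_cong[OF sum_roots_unity_cinner_poly_op[OF that, of p n M h], of Re]
      by (simp add: M_def g_def)
    have "Re_nonneg_on_disc (pcompose p [:0, w:])" if "w ^ M = 1" for w
      using power_eq_1_iff[OF that] by (intro Re_nonneg_on_disc_rotate p_nonneg) (simp add: M_def)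
    then have "real M * Re (weighted_toeplitz_form (coeff p) T h n)
        \<le> real M * (c * Re (weighted_toeplitz_form (coeff p) T' h n))"
      unfolding mult.left_commute[of _ c] average[OF T] average[OF T'] sum_distrib_left
      by (intro sum_mono form_le) simp
    then show ?thesis
      by (simp add: M_def)
  qed
  then show thesis
    using that \<open>c \<ge> 1\<close> by blast
qed

lemma harnack_dominated_toeplitz_form:
  fixes T T' :: "'a::complex_hilbert_space \<Rightarrow> 'a"
  assumes "bounded_clinear T" "bounded_clinear T'" "harnack_dominated T T'"
  obtains c where "c \<ge> 1" "\<And>h n. toeplitz_form T h n \<le> c * toeplitz_form T' h n"
proof -
  obtain c where "c \<ge> 1" and weighted_le: "\<And>p h n. Re_nonneg_on_disc p \<Longrightarrow>
      Re (weighted_toeplitz_form (coeff p) T h n)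
        \<le> c * Re (weighted_toeplitz_form (coeff p) T' h n)"
    using harnack_dominated_weighted_toeplitz_form[OF assms] by metis
  have tendsto_form: "(\<lambda>N. Re (weighted_toeplitz_form (coeff (fejer_poly N)) S h n))
      \<longlonglongrightarrow> toeplitz_form S h n" for S :: "'a \<Rightarrow> 'a" and h n
    unfolding toeplitz_form_def
    by (intro tendsto_Re tendsto_weighted_toeplitz_form tendsto_coeff_fejer_poly)
  have "toeplitz_form T h n \<le> c * toeplitz_form T' h n" for h n
    using tendsto_form tendsto_mult_left[OF tendsto_form]
    by (rule LIMSEQ_le) (auto intro: weighted_le Re_nonneg_on_disc_fejer_poly)
  then show thesis
    using that \<open>c \<ge> 1\<close> by blast
qed

section \<open>Harnack domination and isometric parts\<close>

lemma harnack_dominated_eq_if_isometric: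
  assumes T: "contraction T" and T': "contraction T'" and dom: "harnack_dominated T T'"
    and iso: "norm (T' x) = norm x"
  shows "T x = T' x"
proof -
  obtain c where "c \<ge> 1" and form_le: "\<And>h n. toeplitz_form T h n \<le> c * toeplitz_form T' h n"
    using harnack_dominated_toeplitz_form[OF contraction_imp_bounded_clinear[OF T]
        contraction_imp_bounded_clinear[OF T'] dom] by metis
  define h where "h j = (if j = 0 then - T' x else x)" for j :: nat
  have form_eq: "toeplitz_form S h 2 = 2 * (norm x)\<^sup>2 - 2 * Re (cinner (S x) (T' x))" for S
    by (simp add: toeplitz_form_eq h_def numeral_2_eq_2 cinner.minus_right iso)
  have "toeplitz_form T' h 2 = 0"
    by (simp add: form_eq cinner_self iso)
  then have "2 * (norm x)\<^sup>2 - 2 * Re (cinner (T x) (T' x)) \<le> 0"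
    using form_le[of h 2] by (simp add: form_eq)
  moreover have "(norm (T x))\<^sup>2 \<le> (norm x)\<^sup>2"
    by (intro power_mono contraction_norm_le[OF T]) simp
  ultimately have "(norm (T x - T' x))\<^sup>2 \<le> 0"
    unfolding norm_diff_power2 iso by linarith
  then show ?thesis by simp
qed

lemma harnack_dominated_isometric_part_mono:
  assumes "contraction T" "contraction T'" "harnack_dominated T T'"
  shows "isometric_part T' \<subseteq> isometric_part T"
proof (rule subset_isometric_part)
  have eq: "T x = T' x" if "x \<in> isometric_part T'" for x
    using assms norm_eq_on_isometric_part[OF that] by (rule harnack_dominated_eq_if_isometric)
  then show "T ` isometric_part T' \<subseteq> isometric_part T'"
    using isometric_part_invariant[of T'] by auto
  show "norm (T x) = norm x" if "x \<in> isometric_part T'" for x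
    using norm_eq_on_isometric_part[OF that] eq[OF that] by simp
qed

lemma harnack_dominated_reduces_reducing_isometric_part:
  assumes T: "contraction T" and T': "contraction T'" and "T \<circ> T' = T' \<circ> T"
    and dom: "harnack_dominated T T'"
  shows "reduces (reducing_isometric_part T') T"
proof -
  let ?M = "reducing_isometric_part T'"
  note iso = norm_eq_on_reducing_isometric_part[OF T']
  have "T x = T' x" if "x \<in> ?M" for x
    using T T' dom iso[OF that] by (rule harnack_dominated_eq_if_isometric)
  moreover from this have "cadjoint T x = cadjoint T' x" if "x \<in> ?M" for x
    using assms iso[OF that] that by (intro cadjoint_eq_if_commute_isometric)
  ultimately show ?thesis
    using reduces_reducing_isometric_part[OF T'] by (auto simp: reduces_def)
qed

lemma toeplitz_form_isometric_part:
  assumes T: "contraction T" and h_mem: "\<And>j. j < n \<Longrightarrow> h j \<in> isometric_part T"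
  shows "toeplitz_form T h n = (norm (\<Sum>j<n. (T ^^ j) (h j)))\<^sup>2"
  using h_mem
proof (induction n)
  case (Suc n)
  have "cinner ((T ^^ n) (h n)) ((T ^^ i) (h i)) = cinner ((T ^^ (n - i)) (h n)) (h i)"
    if "i < n" for i
  proof -
    have "(T ^^ n) (h n) = (T ^^ i) ((T ^^ (n - i)) (h n))"
      using that by (simp add: funpow_add_apply)
    then show ?thesis
      using Suc.prems that by (simp add: cinner_funpow_isometric_part[OF T])
  qed
  then have "Re (cinner (\<Sum>i<n. (T ^^ i) (h i)) ((T ^^ n) (h n)))
      = (\<Sum>i<n. Re (cinner ((T ^^ (n - i)) (h n)) (h i)))"
    by (subst Re_cinner_commute) (simp add: cinner.sum_right)
  then show ?case
    using Suc by (simp add: toeplitz_form_eq norm_add_power2 isometric_partD)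
qed (simp add: toeplitz_form_eq)

lemma sum_funpow_diff_telescope:
  assumes lin: "bounded_clinear S" "bounded_clinear T" and comm: "S \<circ> T = T \<circ> S"
  shows "(\<Sum>k<n. (S ^^ (n - Suc k)) ((T ^^ k) (S z - T z))) = (S ^^ n) z - (T ^^ n) z"
proof -
  define f where "f k = (S ^^ (n - k)) ((T ^^ k) z)" for k
  have diff: "(S ^^ k) (x - y) = (S ^^ k) x - (S ^^ k) y"
    "(T ^^ k) (x - y) = (T ^^ k) x - (T ^^ k) y" for k x y
    using lin
    by (simp_all add: bounded_clinear_imp_bounded_linear bounded_clinear_funpow linear_simps)
  have "(S ^^ (n - Suc k)) ((T ^^ k) (S z - T z)) = f k - f (Suc k)" if "k < n" for k
  proof -
    have "(S ^^ (n - Suc k)) ((T ^^ k) (S z)) = (S ^^ Suc (n - Suc k)) ((T ^^ k) z)"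
      using funpow_commute_funpow[OF comm, of 1 k z] by (simp add: funpow_swap1)
    then show ?thesis
      using that by (simp add: diff f_def Suc_diff_Suc funpow_swap1)
  qed
  then have "(\<Sum>k<n. (S ^^ (n - Suc k)) ((T ^^ k) (S z - T z))) = (\<Sum>k<n. f k - f (Suc k))"
    by simp
  also have "\<dots> = (S ^^ n) z - (T ^^ n) z"
    unfolding sum_lessThan_telescope' by (simp add: f_def)
  finally show ?thesis .
qed

lemma sum_Re_cinner_funpow_diff_le:
  assumes T: "contraction T" and T': "contraction T'" and comm: "T \<circ> T' = T' \<circ> T"
    and y_eq: "y = T z - T' z" and y_mem: "y \<in> isometric_part T"
  shows "(\<Sum>k<Suc j. Re (cinner ((T' ^^ k) y) ((T ^^ k) y))) \<le> 2 * norm z * norm y"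
proof -
  have "cinner ((T' ^^ k) y) ((T ^^ k) y) = cinner ((T ^^ (j - k)) ((T' ^^ k) y)) ((T ^^ j) y)"
    if "k \<le> j" for k
  proof -
    have "(T ^^ j) y = (T ^^ (j - k)) ((T ^^ k) y)"
      using that by (simp add: funpow_add_apply)
    then show ?thesis
      by (simp add: cinner_funpow_isometric_part[OF T] funpow_mem_isometric_part y_mem)
  qed
  then have "(\<Sum>k<Suc j. Re (cinner ((T' ^^ k) y) ((T ^^ k) y)))
      = Re (cinner (\<Sum>k<Suc j. (T ^^ (Suc j - Suc k)) ((T' ^^ k) y)) ((T ^^ j) y))"
    unfolding cinner.sum_left Re_sum by (intro sum.cong) auto
  also have "\<dots> = Re (cinner ((T ^^ Suc j) z - (T' ^^ Suc j) z) ((T ^^ j) y))"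
    unfolding y_eq using T T' comm
    by (subst sum_funpow_diff_telescope) (simp_all add: contraction_imp_bounded_clinear)
  also have "\<dots> \<le> norm ((T ^^ Suc j) z - (T' ^^ Suc j) z) * norm ((T ^^ j) y)"
    by (rule Re_cinner_le)
  also have "\<dots> \<le> (norm z + norm z) * norm y"
    by (intro mult_mono norm_triangle_le_diff add_mono contraction_norm_le contraction_funpow T T')
      auto
  finally show ?thesis by simp
qed

lemma toeplitz_form_orbit_le:
  assumes T: "contraction T" and T': "contraction T'" and comm: "T \<circ> T' = T' \<circ> T"
    and y_eq: "y = T z - T' z" and y_mem: "y \<in> isometric_part T"
  shows "toeplitz_form T' (\<lambda>j. (T ^^ (n - j)) y) n \<le> real n * (4 * norm z * norm y)"
proof -
  define a where "a k = Re (cinner ((T' ^^ k) y) ((T ^^ k) y))" for k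
  have row_sum: "(\<Sum>i<j. Re (cinner ((T' ^^ (j - i)) ((T ^^ (n - j)) y)) ((T ^^ (n - i)) y)))
      = (\<Sum>k<Suc j. a k) - (norm y)\<^sup>2" if "j < n" for j
  proof -
    have "Re (cinner ((T' ^^ (j - i)) ((T ^^ (n - j)) y)) ((T ^^ (n - i)) y)) = a (j - i)"
      if "i < j" for i
    proof -
      have "(T ^^ (n - i)) y = (T ^^ (n - j)) ((T ^^ (j - i)) y)"
        using \<open>i < j\<close> \<open>j < n\<close> by (simp add: funpow_add_apply)
      then show ?thesis
        by (simp add: a_def cinner_funpow_isometric_part[OF T] funpow_mem_isometric_part y_mem
            flip: funpow_commute_funpow[OF comm])
    qed
    then have "(\<Sum>i<j. Re (cinner ((T' ^^ (j - i)) ((T ^^ (n - j)) y)) ((T ^^ (n - i)) y)))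
        = (\<Sum>i<j. a (Suc (j - Suc i)))"
      by (simp add: Suc_diff_Suc)
    also have "\<dots> = (\<Sum>k<j. a (Suc k))"
      by (rule sum.nat_diff_reindex)
    also have "\<dots> = (\<Sum>k<Suc j. a k) - (norm y)\<^sup>2"
      unfolding sum.lessThan_Suc_shift by (simp add: a_def cinner_self)
    finally show ?thesis .
  qed
  have "(norm ((T ^^ (n - j)) y))\<^sup>2
      + 2 * (\<Sum>i<j. Re (cinner ((T' ^^ (j - i)) ((T ^^ (n - j)) y)) ((T ^^ (n - i)) y)))
      \<le> 4 * norm z * norm y" if "j < n" for j
    using sum_Re_cinner_funpow_diff_le[OF assms, of j] zero_le_power2[of "norm y"]
    unfolding row_sum[OF that] isometric_partD[OF y_mem] a_def by argo
  then have "toeplitz_form T' (\<lambda>j. (T ^^ (n - j)) y) n \<le> (\<Sum>j<n. 4 * norm z * norm y)"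
    unfolding toeplitz_form_eq by (intro sum_mono) simp
  then show ?thesis by simp
qed

text \<open>
  For \<open>y = T z - T' z\<close> and \<open>h j = T\<^sup>n\<^sup>-\<^sup>j y\<close>, the form of \<open>T\<close> is \<open>n\<^sup>2 \<parallel>y\<parallel>\<^sup>2\<close>, whereas that of
  \<open>T'\<close> grows only linearly in \<open>n\<close>. This is the mean ergodic theorem for \<open>T\<^sup>-\<^sup>1 T'\<close> in disguise.
\<close>

lemma harnack_dominated_eq_if_diff_mem_isometric_part:
  assumes T: "contraction T" and T': "contraction T'" and comm: "T \<circ> T' = T' \<circ> T"
    and dom: "harnack_dominated T T'" and mem: "T z - T' z \<in> isometric_part T"
  shows "T z = T' z"
proof -
  obtain c where "c \<ge> 1" and form_le: "\<And>h n. toeplitz_form T h n \<le> c * toeplitz_form T' h n"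
    using harnack_dominated_toeplitz_form[OF contraction_imp_bounded_clinear[OF T]
        contraction_imp_bounded_clinear[OF T'] dom] by metis
  define y where "y = T z - T' z"
  have y_mem: "y \<in> isometric_part T"
    unfolding y_def by (rule mem)
  have "real n * (norm y)\<^sup>2 \<le> c * (4 * norm z * norm y)" if "n > 0" for n
  proof -
    define h where "h j = (T ^^ (n - j)) y" for j
    have "(\<Sum>j<n. (T ^^ j) (h j)) = (\<Sum>j<n. (T ^^ n) y)"
      by (simp add: h_def funpow_add_apply)
    then have "(real n * norm y)\<^sup>2 = toeplitz_form T h n"
      by (simp add: toeplitz_form_isometric_part[OF T] h_def funpow_mem_isometric_part y_mem
          isometric_partD sum_constant_scaleR)
    also have "\<dots> \<le> c * toeplitz_form T' h n"
      by (rule form_le)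
    also have "\<dots> \<le> c * (real n * (4 * norm z * norm y))"
      unfolding h_def using \<open>c \<ge> 1\<close>
      by (intro mult_left_mono toeplitz_form_orbit_le[OF T T' comm y_def y_mem]) simp
    finally have "real n * (real n * (norm y)\<^sup>2) \<le> real n * (c * (4 * norm z * norm y))"
      by (simp add: power2_eq_square mult_ac)
    then show ?thesis
      using \<open>n > 0\<close> by simp
  qed
  then have "(norm y)\<^sup>2 = 0"
    using \<open>c \<ge> 1\<close> by (intro real_archimedian_rdiv_eq_0) auto
  then show ?thesis
    by (simp add: y_def)
qed

lemma harnack_dominated_isometric_part_subset_reducing:
  assumes T: "contraction T" and T': "contraction T'" and comm: "T \<circ> T' = T' \<circ> T"
    and dom: "harnack_dominated T T'" and red: "reduces (isometric_part T) T'"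
  shows "isometric_part T \<subseteq> reducing_isometric_part T'"
proof (rule reducing_isometric_part_greatest[OF T' red subset_isometric_part])
  show T'_inv: "T' ` isometric_part T \<subseteq> isometric_part T"
    using red by (simp add: reduces_def)
  fix z assume z: "z \<in> isometric_part T"
  have "T z - T' z \<in> isometric_part T"
    using closed_csubspace_isometric_part[OF T] isometric_part_invariant[of T] T'_inv z
    by (intro subspace_diff) (auto simp: closed_csubspace_def)
  then have "T z = T' z"
    by (rule harnack_dominated_eq_if_diff_mem_isometric_part[OF T T' comm dom])
  then show "norm (T' z) = norm z"
    using norm_eq_on_isometric_part[OF z] by simp
qed

lemma harnack_dominated_reducing_isometric_part_mono:
  assumes T: "contraction T" and T': "contraction T'" and "T \<circ> T' = T' \<circ> T"
    and dom: "harnack_dominated T T'"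
  shows "reducing_isometric_part T' \<subseteq> reducing_isometric_part T"
  using reducing_isometric_part_subset[OF T'] harnack_dominated_isometric_part_mono[OF T T' dom]
  by (intro reducing_isometric_part_greatest[OF T]
      harnack_dominated_reduces_reducing_isometric_part[OF assms]) simp

theorem theorem2p6:
  fixes T T' :: "'h::complex_hilbert_space \<Rightarrow> 'h"
  assumes "contraction T" and "contraction T'"
    and "T \<circ> T' = T' \<circ> T"
    and "harnack_dominated T T'"
  shows
    "(reducing_isometric_part T' \<subseteq> reducing_isometric_part T \<and>
      (\<forall>h\<in>reducing_isometric_part T'. T' h = T h))
     \<and>
     (reducing_isometric_part T \<subseteq> null_space (defect_op T') \<longrightarrow>
        reduces (reducing_isometric_part T') T \<and>
        (reduces (null_space (\<lambda>h. h - asymptotic_limit T h)) T' \<longrightarrow>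
           reducing_isometric_part T = reducing_isometric_part T' \<and>
           reducing_isometric_part T' = null_space (\<lambda>h. h - asymptotic_limit T' h) \<and>
           null_space (\<lambda>h. h - asymptotic_limit T' h) = null_space (\<lambda>h. h - asymptotic_limit T h)))
     \<and>
     (\<forall>(J :: 'h \<Rightarrow> 'k::complex_hilbert_space) V (J' :: 'h \<Rightarrow> 'l::complex_hilbert_space) V' A.
        minimal_isometric_dilation T J V \<and> minimal_isometric_dilation T' J' V' \<and>
        harnack_operator J V J' V' A \<and> inj A \<longrightarrow>
        reduces (reducing_isometric_part T') T)
     \<and>
     (harnack_equivalent T T' \<longrightarrow> reducing_isometric_part T = reducing_isometric_part T')"
proof -
  note T = assms(1) and T' = assms(2) and comm = assms(3) and dom = assms(4)
  have red: "reduces (reducing_isometric_part T') T"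
    by (rule harnack_dominated_reduces_reducing_isometric_part[OF T T' comm dom])
  have mono: "reducing_isometric_part T' \<subseteq> reducing_isometric_part T"
    by (rule harnack_dominated_reducing_isometric_part_mono[OF T T' comm dom])
  have eq: "T' h = T h" if "h \<in> reducing_isometric_part T'" for h
    using harnack_dominated_eq_if_isometric[OF T T' dom
        norm_eq_on_reducing_isometric_part[OF T' that]] by simp
  have "reducing_isometric_part T = reducing_isometric_part T'
      \<and> reducing_isometric_part T' = isometric_part T' \<and> isometric_part T' = isometric_part T"
    if "reduces (isometric_part T) T'"
    using harnack_dominated_isometric_part_subset_reducing[OF T T' comm dom that]
      harnack_dominated_isometric_part_mono[OF T T' dom]
      reducing_isometric_part_subset[OF T] reducing_isometric_part_subset[OF T'] mono by blast
  moreover have "reducing_isometric_part T = reducing_isometric_part T'"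
    if "harnack_equivalent T T'"
    using that harnack_dominated_reducing_isometric_part_mono[OF T' T comm[symmetric]] mono
    by (auto simp: harnack_equivalent_def)
  ultimately show ?thesis
    unfolding null_space_asymptotic_limit[OF T] null_space_asymptotic_limit[OF T']
    using red mono eq by blast
qed

end
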